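(* Let $n\ge1$. For all $x,y\in\mathbb R^n$, $$\lim_{p\to\infty}d_{\varphi_p}(x,y)=d_\boxplus(x,y).$$
   Context: Notation: $[n]=\{1,\dots,n\}$. For $p\in\mathbb N$, $\varphi_p:\mathbb R\to\mathbb R$ is the bijection $\varphi_p(\lambda)=\lambda^{2p+1}$ and $\phi_p:\mathbb R^n\to\mathbb R^n$ is $\phi_p(x)=(\varphi_p(x_1),\dots,\varphi_p(x_n))$. Set $x\stackrel{p}{+}y=\phi_p^{-1}(\phi_p(x)+\phi_p(y))$ and $x\stackrel{p}{-}y=x\stackrel{p}{+}(-y)$. With $\|\cdot\|$ the Euclidean norm, $\|x\|_{\varphi_p}=\varphi_p^{-1}(\|\phi_p(x)\|)$ and $d_{\varphi_p}(x,y)=\|x\stackrel{p}{-}y\|_{\varphi_p}$. For $\lambda,\mu\in\mathbb R$, $\lambda\boxplus\mu=\lambda$ if $|\lambda|>|\mu|$, $\frac12(\lambda+\mu)$ if $|\lambda|=|\mu|$, and $\mu$ if $|\lambda|<|\mu|$; $\lambda\boxminus\mu=\lambda\boxplus(-\mu)$. Finally $d_\boxplus(x,y)=\max_{i\in[n]}|x_i\boxminus y_i|$. *)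

theory Defs
  imports "HOL-Analysis.Analysis"
begin

definition varphi :: "nat \<Rightarrow> real \<Rightarrow> real" where
  "varphi p l = l ^ (2 * p + 1)"

definition phi :: "nat \<Rightarrow> real ^ 'n \<Rightarrow> real ^ 'n" where
  "phi p x = (\<chi> i. varphi p (x $ i))"

text \<open>The inverses of \<open>varphi p\<close> and \<open>phi p\<close> are taken with \<open>inv\<close>;
  the following lemmas show that these are genuine two-sided inverses.\<close>

lemma bij_varphi: "bij (varphi p)"
proof (rule bij_betw_byWitness[where f' = "root (2 * p + 1)"])
  show "\<forall>a\<in>UNIV. root (2 * p + 1) (varphi p a) = a"
    unfolding varphi_def by (intro ballI odd_real_root_power_cancel) simp
  show "\<forall>a\<in>UNIV. varphi p (root (2 * p + 1) a) = a"
    unfolding varphi_def by (intro ballI odd_real_root_pow) simp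
qed auto

lemma bij_phi: "bij (phi p :: real ^ 'n \<Rightarrow> real ^ 'n)"
proof (rule bij_betw_byWitness[where f' = "\<lambda>y. \<chi> i. inv (varphi p) (y $ i)"])
  show "\<forall>a\<in>UNIV. (\<chi> i. inv (varphi p) (phi p a $ i)) = (a :: real ^ 'n)"
    by (simp add: phi_def vec_eq_iff inv_f_f[OF bij_is_inj[OF bij_varphi]])
  show "\<forall>a\<in>UNIV. phi p (\<chi> i. inv (varphi p) (a $ i)) = (a :: real ^ 'n)"
    by (simp add: phi_def vec_eq_iff surj_f_inv_f[OF bij_is_surj[OF bij_varphi]])
qed auto

definition padd :: "nat \<Rightarrow> real ^ 'n \<Rightarrow> real ^ 'n \<Rightarrow> real ^ 'n" where
  "padd p x y = inv (phi p) (phi p x + phi p y)"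

definition pminus :: "nat \<Rightarrow> real ^ 'n \<Rightarrow> real ^ 'n \<Rightarrow> real ^ 'n" where
  "pminus p x y = padd p x (- y)"

definition norm_varphi :: "nat \<Rightarrow> real ^ 'n \<Rightarrow> real" where
  "norm_varphi p x = inv (varphi p) (norm (phi p x))"

definition dist_varphi :: "nat \<Rightarrow> real ^ 'n \<Rightarrow> real ^ 'n \<Rightarrow> real" where
  "dist_varphi p x y = norm_varphi p (pminus p x y)"

definition boxplus :: "real \<Rightarrow> real \<Rightarrow> real" (infixl "\<boxplus>" 65) where
  "l \<boxplus> m = (if \<bar>l\<bar> > \<bar>m\<bar> then l else if \<bar>l\<bar> = \<bar>m\<bar> then (l + m) / 2 else m)"

definition boxminus :: "real \<Rightarrow> real \<Rightarrow> real" (infixl "\<boxminus>" 65) where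
  "l \<boxminus> m = l \<boxplus> (- m)"

definition dist_boxplus :: "real ^ 'n \<Rightarrow> real ^ 'n \<Rightarrow> real" where
  "dist_boxplus x y = Max (range (\<lambda>i. \<bar>x $ i \<boxminus> y $ i\<bar>))"

end

theory Submission
  imports Defs
begin

text \<open>
  Writing \<open>k = 2 p + 1\<close>, the vector \<open>pminus p x y\<close> has components
  \<open>root k (x\<^sub>i ^ k - y\<^sub>i ^ k)\<close>, which converge to \<open>x\<^sub>i \<boxminus> y\<^sub>i\<close> because the power of larger
  modulus dominates. Since the Euclidean norm lies between the maximum norm and \<open>n\<close> times it,
  \<open>norm_varphi p z\<close> lies between \<open>infnorm z\<close> and \<open>root k n * infnorm z\<close>, and \<open>root k n\<close>
  tends to 1. Hence the limit is the maximum norm of the limit vector.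
\<close>

lemma root_odd_power_cancel: "root (2 * p + 1) (a ^ (2 * p + 1)) = a"
  by (intro odd_real_root_power_cancel) simp

lemma inv_varphi: "inv (varphi p) = root (2 * p + 1)"
proof (rule inv_equality)
  show "root (2 * p + 1) (varphi p a) = a" for a
    unfolding varphi_def by (rule root_odd_power_cancel)
  show "varphi p (root (2 * p + 1) a) = a" for a
    unfolding varphi_def by (intro odd_real_root_pow) simp
qed

lemma inv_phi_nth: "inv (phi p) z $ i = root (2 * p + 1) (z $ i)"
proof -
  have "varphi p (inv (phi p) z $ i) = z $ i"
    using surj_f_inv_f[OF bij_is_surj[OF bij_phi], of p z] by (simp add: phi_def vec_eq_iff)
  then show ?thesis
    by (metis inv_varphi inv_f_f[OF bij_is_inj[OF bij_varphi]])
qed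

lemma pminus_nth:
  "pminus p x y $ i = root (2 * p + 1) ((x $ i) ^ (2 * p + 1) - (y $ i) ^ (2 * p + 1))"
  by (simp add: pminus_def padd_def inv_phi_nth phi_def varphi_def)

lemma filterlim_odd_at_top: "filterlim (\<lambda>p::nat. 2 * p + 1) sequentially sequentially"
  by (rule filterlim_at_top_mono[OF filterlim_ident]) auto

lemma root_odd_const_tendsto:
  fixes c :: real
  assumes "c > 0"
  shows "(\<lambda>p. root (2 * p + 1) c) \<longlonglongrightarrow> 1"
  using filterlim_compose[OF LIMSEQ_root_const[OF assms] filterlim_odd_at_top] .

text \<open>As the exponent is at least 1, the radicand stays between the positive constants
  \<open>1 - \<bar>r\<bar>\<close> and 2, whose roots both tend to 1.\<close>

lemma root_one_minus_power_tendsto: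
  fixes r :: real
  assumes "\<bar>r\<bar> < 1"
  shows "(\<lambda>p. root (2 * p + 1) (1 - r ^ (2 * p + 1))) \<longlonglongrightarrow> 1"
proof (rule tendsto_sandwich)
  have power: "\<bar>r ^ (2 * p + 1)\<bar> \<le> \<bar>r\<bar>" for p
    using power_decreasing[of 1 "2 * p + 1" "\<bar>r\<bar>"] assms by (simp only: power_abs) simp
  show "\<forall>\<^sub>F p in sequentially. root (2 * p + 1) (1 - \<bar>r\<bar>) \<le> root (2 * p + 1) (1 - r ^ (2 * p + 1))"
    using power by (intro always_eventually allI real_root_le_mono) (auto simp: abs_le_iff)
  show "\<forall>\<^sub>F p in sequentially. root (2 * p + 1) (1 - r ^ (2 * p + 1)) \<le> root (2 * p + 1) 2"
  proof (intro always_eventually allI real_root_le_mono)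
    show "1 - r ^ (2 * p + 1) \<le> 2" for p
      using power[of p] assms by linarith
  qed simp
qed (use assms in \<open>auto intro!: root_odd_const_tendsto simp del: One_nat_def\<close>)

text \<open>Factor out \<open>a ^ k\<close>: its odd root is \<open>a\<close> with the correct sign,
  and what remains is the previous limit at \<open>r = b / a\<close>.\<close>

lemma root_diff_tendsto_of_dominant:
  fixes a b :: real
  assumes "\<bar>b\<bar> < \<bar>a\<bar>"
  shows "(\<lambda>p. root (2 * p + 1) (a ^ (2 * p + 1) - b ^ (2 * p + 1))) \<longlonglongrightarrow> a"
proof -
  have "a ^ k - b ^ k = a ^ k * (1 - (b / a) ^ k)" for k
    using assms by (simp add: power_divide right_diff_distrib)
  then have "root (2 * p + 1) (a ^ (2 * p + 1) - b ^ (2 * p + 1))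
      = a * root (2 * p + 1) (1 - (b / a) ^ (2 * p + 1))" for p
    by (simp only: real_root_mult root_odd_power_cancel)
  moreover have "\<bar>b / a\<bar> < 1"
    using assms by simp
  ultimately show ?thesis
    using tendsto_mult_left[OF root_one_minus_power_tendsto, of "b / a" a] by simp
qed

lemma root_diff_tendsto_boxminus:
  fixes a b :: real
  shows "(\<lambda>p. root (2 * p + 1) (a ^ (2 * p + 1) - b ^ (2 * p + 1))) \<longlonglongrightarrow> a \<boxminus> b"
proof -
  consider "\<bar>b\<bar> < \<bar>a\<bar>" | "\<bar>a\<bar> < \<bar>b\<bar>" | "a = b" | "b = - a"
    by linarith
  then show ?thesis
  proof cases
    case 1
    then show ?thesis
      using root_diff_tendsto_of_dominant[OF 1] by (simp add: boxminus_def boxplus_def)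
  next
    \<comment> \<open>Odd roots commute with negation, so the dominant case with \<open>a\<close>
      and \<open>b\<close> exchanged gives the limit \<open>- b\<close>.\<close>
    case 2
    then show ?thesis
      using tendsto_minus[OF root_diff_tendsto_of_dominant[OF 2]]
      by (simp add: boxminus_def boxplus_def flip: real_root_minus)
  next
    case 3
    then show ?thesis
      by (simp add: boxminus_def boxplus_def)
  next
    case 4
    \<comment> \<open>The exponent is odd, so \<open>b = - a\<close> makes the two powers add up;
      the factor \<open>root (2 * p + 1) 2\<close> disappears in the limit.\<close>
    have "root (2 * p + 1) (a ^ (2 * p + 1) - b ^ (2 * p + 1)) = root (2 * p + 1) 2 * a" for p
    proof -
      have "a ^ (2 * p + 1) - b ^ (2 * p + 1) = 2 * a ^ (2 * p + 1)"
        using 4 by simp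
      then show ?thesis
        by (simp only: real_root_mult root_odd_power_cancel)
    qed
    then show ?thesis
      using 4 tendsto_mult_right[OF root_odd_const_tendsto[of 2], of a]
      by (simp add: boxminus_def boxplus_def)
  qed
qed

lemma pminus_tendsto: "(\<lambda>p. pminus p x y) \<longlonglongrightarrow> (\<chi> i. x $ i \<boxminus> y $ i)"
  by (rule vec_tendstoI) (simp only: pminus_nth vec_lambda_beta root_diff_tendsto_boxminus)

text \<open>Identifies the maximum in \<open>dist_boxplus\<close> with \<open>infnorm\<close>, whose
  continuity carries the coordinatewise limit over to the norms.\<close>

lemma infnorm_eq_Max: "infnorm z = Max (range (\<lambda>i. \<bar>z $ i\<bar>))"
proof -
  have "{\<bar>z $ i\<bar> |i. i \<in> UNIV} = range (\<lambda>i. \<bar>z $ i\<bar>)"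
    by auto
  then show ?thesis
    by (simp add: infnorm_cart cSup_eq_Max)
qed

lemma norm_varphi_ge_infnorm: "infnorm z \<le> norm_varphi p z"
proof -
  have "\<bar>z $ i\<bar> \<le> norm_varphi p z" for i
  proof -
    have "\<bar>z $ i\<bar> ^ (2 * p + 1) \<le> norm (phi p z)"
      using component_le_norm_cart[of "phi p z" i]
      by (simp only: phi_def varphi_def vec_lambda_beta power_abs)
    then have "root (2 * p + 1) (\<bar>z $ i\<bar> ^ (2 * p + 1)) \<le> norm_varphi p z"
      unfolding norm_varphi_def inv_varphi by (intro real_root_le_mono) auto
    then show ?thesis
      by (simp only: root_odd_power_cancel)
  qed
  then show ?thesis
    by (auto simp: infnorm_eq_Max)
qed

text \<open>The crude l1 bound suffices: any constant factor independent of \<open>p\<close> becomes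
  a root tending to 1.\<close>

lemma norm_varphi_le_infnorm:
  fixes z :: "real ^ 'n"
  shows "norm_varphi p z \<le> root (2 * p + 1) CARD('n) * infnorm z"
proof -
  have "norm (phi p z) \<le> (\<Sum>i\<in>UNIV. \<bar>phi p z $ i\<bar>)"
    by (rule norm_le_l1_cart)
  also have "\<dots> \<le> (\<Sum>i\<in>(UNIV :: 'n set). infnorm z ^ (2 * p + 1))"
    unfolding phi_def varphi_def vec_lambda_beta power_abs
    by (intro sum_mono power_mono component_le_infnorm_cart) auto
  finally have "norm (phi p z) \<le> real CARD('n) * infnorm z ^ (2 * p + 1)"
    by simp
  then have "norm_varphi p z \<le> root (2 * p + 1) (real CARD('n) * infnorm z ^ (2 * p + 1))"
    unfolding norm_varphi_def inv_varphi by (intro real_root_le_mono) auto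
  also have "\<dots> = root (2 * p + 1) CARD('n) * infnorm z"
    by (simp only: real_root_mult root_odd_power_cancel)
  finally show ?thesis .
qed

theorem lemma2p2p2:
  fixes x y :: "real ^ 'n"
  shows "(\<lambda>p. dist_varphi p x y) \<longlonglongrightarrow> dist_boxplus x y"
proof -
  have "dist_boxplus x y = infnorm (\<chi> i. x $ i \<boxminus> y $ i)"
    by (simp add: dist_boxplus_def infnorm_eq_Max)
  then have lower: "(\<lambda>p. infnorm (pminus p x y)) \<longlonglongrightarrow> dist_boxplus x y"
    using tendsto_infnorm[OF pminus_tendsto] by simp
  have "(\<lambda>p. root (2 * p + 1) CARD('n)) \<longlonglongrightarrow> 1"
    by (rule root_odd_const_tendsto) simp
  from tendsto_mult[OF this lower]
  have upper: "(\<lambda>p. root (2 * p + 1) CARD('n) * infnorm (pminus p x y)) \<longlonglongrightarrow> dist_boxplus x y"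
    by simp
  \<comment> \<open>Both bounds hold for every vector and every \<open>p\<close>, so they apply at
    \<open>pminus p x y\<close>, which moves with \<open>p\<close>.\<close>
  show ?thesis
    by (rule tendsto_sandwich[OF _ _ lower upper])
      (simp_all only: dist_varphi_def norm_varphi_ge_infnorm norm_varphi_le_infnorm eventually_True)
qed

end
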